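(* Let $r\ge0$ be an integer, let $X_1,\dots,X_n$ be i.i.d. real random variables with an $r$ times differentiable probability density $f$ and characteristic function $\varphi$, and let $f_n^{(r)}(x;h)$ be the sinc estimator of $f^{(r)}$. Suppose there exists $T>0$ such that $\varphi(t)=0$ for $|t|>T$. Then, if $0<h\le \frac1T$, $$\mathrm{MISE}(f_n^{(r)}(x;h))\le\frac{1}{\pi nh^{2r+1}}.$$ In particular, if $h=\mathrm{const}=1/T$, then $$\mathrm{MISE}(f_n^{(r)}(x;h))\le\frac{T^{2r+1}}{\pi n}.$$
   Context: The characteristic function is $\varphi(t)=\mathrm{E}\,e^{itX_j}$. The sinc estimator of $f$ with bandwidth $h>0$ is $f_n(x;h)=\frac{1}{nh}\sum_{j=1}^nK_s\left(\frac{x-X_j}{h}\right)$ with $K_s(x)=\frac{\sin x}{\pi x}$ ($K_s(0)=1/\pi$). The sinc estimator of the derivative $f^{(r)}$ is the $r$-th derivative in $x$: $f_n^{(r)}(x;h)=\frac{1}{nh^{r+1}}\sum_{j=1}^nK_s^{(r)}\left(\frac{x-X_j}{h}\right)$. $\mathrm{MISE}(f_n^{(r)}(x;h))=\mathrm{E}\int_{-\infty}^{\infty}[f_n^{(r)}(x;h)-f^{(r)}(x)]^2\,dx$. The $0$-th derivative of a function is the function itself. *)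

theory Defs
  imports "HOL-Probability.Probability"
begin

definition times_differentiable :: "nat \<Rightarrow> (real \<Rightarrow> real) \<Rightarrow> bool" where
  "times_differentiable r f \<longleftrightarrow> (\<forall>k<r. \<forall>x. ((deriv ^^ k) f) differentiable (at x))"

definition sinc_kernel :: "real \<Rightarrow> real" where
  "sinc_kernel x = (if x = 0 then 1 / pi else sin x / (pi * x))"

text \<open>The argument \<open>xs\<close> is a realisation of the sample; only \<open>xs 1, \<dots>, xs n\<close> are used.\<close>

definition sinc_estimator :: "nat \<Rightarrow> (nat \<Rightarrow> real) \<Rightarrow> real \<Rightarrow> real \<Rightarrow> real" where
  "sinc_estimator n xs h x =
     1 / (real n * h) * (\<Sum>j = 1..n. sinc_kernel ((x - xs j) / h))"

definition sinc_deriv_estimator ::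
    "nat \<Rightarrow> nat \<Rightarrow> (nat \<Rightarrow> real) \<Rightarrow> real \<Rightarrow> real \<Rightarrow> real" where
  "sinc_deriv_estimator r n xs h = (deriv ^^ r) (sinc_estimator n xs h)"

text \<open>Both the expectation and the integral over the line are taken in \<open>[0, \<infinity>]\<close>, so a
  finite bound on this quantity includes the assertion that it is finite; with the Bochner
  integral a divergent integral would count as 0.\<close>

definition MISE :: "'a measure \<Rightarrow> ('a \<Rightarrow> real \<Rightarrow> real) \<Rightarrow> (real \<Rightarrow> real) \<Rightarrow> ennreal" where
  "MISE M est g = (\<integral>\<^sup>+\<omega>. (\<integral>\<^sup>+x. ennreal ((est \<omega> x - g x)\<^sup>2) \<partial>lborel) \<partial>M)"

end

theory Submission
  imports Defs
begin

text \<open>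
  Everything happens on the Fourier side. Put \<open>a = 1 / h\<close> and, for a weight \<open>g\<close> on the band
  \<open>[-a, a]\<close>, let \<open>B g x = 1 / (2\<pi>) \<integral>_{-a}^{a} g t e^(-itx) dt\<close>. The sinc kernel is the transform of
  an indicator function, so the sinc estimator is \<open>B\<close> applied to the empirical characteristic
  function \<open>\<phi>_n t = 1 / n \<Sum> e^(it X_j)\<close>. Since \<open>\<phi>\<close> vanishes outside \<open>[-T, T] \<subseteq> [-a, a]\<close>, the
  inversion formula says that the density is \<open>B \<phi>\<close>. Differentiation under the integral sign
  turns \<open>B g\<close> into \<open>B\<close> of \<open>-it g\<close>. Hence the error of the \<open>r\<close>-th derivative estimator is the real
  part of \<open>B ((-it)^r (\<phi>_n - \<phi>))\<close>: the bias vanishes, and only the stochastic error of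
  \<open>\<phi>_n\<close> is left.

  Plancherel bounds the integrated square of the error by
  \<open>1 / (2\<pi>) \<integral>_{-a}^{a} t^(2r) |\<phi>_n t - \<phi> t|^2 dt\<close>. Take expectations inside the integral;
  \<open>e^(it X_j)\<close> has modulus one and the \<open>X_j\<close> are independent, so the mean of
  \<open>|\<phi>_n t - \<phi> t|^2\<close> is at most \<open>1 / n\<close>. The bound \<open>t^(2r) \<le> a^(2r)\<close> on an interval of length \<open>2a\<close>
  gives \<open>a^(2r+1) / (\<pi> n)\<close>.

  The ingredients are \<open>plancherel_le\<close>, \<open>density_eq_band_synthesis_AE\<close>,
  \<open>higher_deriv_Re_band_synthesis\<close> and \<open>empirical_char_mean_square_error_le\<close>; they are combined in
  \<open>MISE_sinc_deriv_estimator_le\<close>. The inversion formula determines the density only almost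
  everywhere. For \<open>r = 0\<close> this is enough, because the error is integrated; for \<open>r > 0\<close> the density
  is continuous, so the identity holds everywhere and may be differentiated.
\<close>

section \<open>The Plancherel inequality\<close>

lemma borel_measurable_cis [measurable]: "cis \<in> borel_measurable borel"
  by (intro borel_measurable_continuous_onI continuous_intros)

lemma borel_measurable_cnj [measurable]: "cnj \<in> borel_measurable borel"
  by (intro borel_measurable_continuous_onI continuous_intros)

text \<open>
  Fubini for a product kernel damped by a phase: the product of two integrable functions of separate
  variables is integrable on the plane, and a factor of modulus at most one does not harm this. In the
  proof of Plancherel \<open>u\<close> is a complex exponential.
\<close>
lemma integral_swap_bounded_kernel:
  fixes g K :: "real \<Rightarrow> complex" and u :: "real \<Rightarrow> real \<Rightarrow> complex"
  assumes g: "integrable lborel g" and K: "integrable lborel K"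
    and u [measurable]: "case_prod u \<in> borel_measurable (borel \<Otimes>\<^sub>M borel)"
    and u_le: "\<And>s x. norm (u s x) \<le> 1"
  shows "(LINT x|lborel. (LINT s|lborel. g s * u s x) * K x)
       = (LINT s|lborel. g s * (LINT x|lborel. u s x * K x))"
proof -
  have [measurable]: "g \<in> borel_measurable borel" "K \<in> borel_measurable borel"
    using g K by auto
  have int: "integrable (lborel \<Otimes>\<^sub>M lborel) (\<lambda>(s, x). g s * (u s x * K x))"
  proof (rule Bochner_Integration.integrable_bound)
    show "integrable (lborel \<Otimes>\<^sub>M lborel) (\<lambda>(s, x). norm (g s) * norm (K x))"
      using g K by (intro lborel_pair.Fubini_integrable) auto
    show "AE z in lborel \<Otimes>\<^sub>M lborel. norm (case z of (s, x) \<Rightarrow> g s * (u s x * K x))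
        \<le> norm (case z of (s, x) \<Rightarrow> norm (g s) * norm (K x))"
      using u_le by (auto simp: norm_mult intro!: AE_I2 mult_left_mono mult_left_le_one_le)
  qed measurable
  have "(LINT x|lborel. (LINT s|lborel. g s * u s x) * K x)
      = (LINT x|lborel. (LINT s|lborel. g s * (u s x * K x)))"
  proof (intro Bochner_Integration.integral_cong refl)
    fix x
    have "integrable lborel (\<lambda>s. g s * u s x)"
      using u_le by (intro Bochner_Integration.integrable_bound[OF g])
        (auto simp: norm_mult intro!: AE_I2 mult_left_le)
    then show "(LINT s|lborel. g s * u s x) * K x = (LINT s|lborel. g s * (u s x * K x))"
      by (simp flip: integral_mult_left_zero add: mult.assoc)
  qed
  also have "\<dots> = (LINT s|lborel. (LINT x|lborel. g s * (u s x * K x)))"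
    using lborel_pair.Fubini_integral[OF int] by simp
  finally show ?thesis by simp
qed

text \<open>
  The Gaussian weights used to regularise Plancherel. Writing the transform as \<open>2\<pi>\<close> times a normal
  density shows at once that it is nonnegative with total mass \<open>2\<pi>\<close>, whatever the width.
\<close>
lemma gaussian_fourier:
  assumes "0 < e"
  shows "integrable lborel (\<lambda>x. exp (- (e * x)\<^sup>2 / 2))" (is ?int)
    and "(CLINT x|lborel. cis (s * x) * exp (- (e * x)\<^sup>2 / 2)) = 2 * pi * normal_density 0 e s" (is ?eq)
proof -
  have nd: "exp (- (e * x)\<^sup>2 / 2) = sqrt (2 * pi) * std_normal_density (0 + e * x)" for x
    by (simp add: std_normal_density_def)
  show ?int
    unfolding nd using assms
    by (intro integrable_mult_right lborel_integrable_real_affine) auto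
  have "(CLINT x|lborel. cis (s * x) * exp (- (e * x)\<^sup>2 / 2))
      = sqrt (2 * pi) * (CLINT x|lborel. iexp (s / e * (0 + e * x)) * std_normal_density (0 + e * x))"
    unfolding nd using assms
    by (subst integral_mult_right_zero [symmetric])
       (auto intro!: Bochner_Integration.integral_cong simp: cis_conv_exp mult_ac)
  also have "(CLINT x|lborel. iexp (s / e * (0 + e * x)) * std_normal_density (0 + e * x))
      = (CLINT x|lborel. iexp (s / e * x) * std_normal_density x) / e"
    using assms by (subst (2) lborel_integral_real_affine[where c = e and t = 0])
      (auto simp: scaleR_conv_of_real)
  also have "(CLINT x|lborel. iexp (s / e * x) * std_normal_density x)
      = char std_normal_distribution (s / e)"
    unfolding char_def by (subst integral_density)
      (auto simp: scaleR_conv_of_real mult_ac intro!: AE_I2)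
  also have "\<dots> = exp (- (s / e)\<^sup>2 / 2)"
    by (simp add: char_std_normal_distribution)
  finally have *: "(CLINT x|lborel. cis (s * x) * exp (- (e * x)\<^sup>2 / 2)) =
     complex_of_real (sqrt (2 * pi) * (exp (- (s / e)\<^sup>2 / 2) / e))" by simp
  have r: "sqrt (2 * pi) * (exp (- (s / e)\<^sup>2 / 2) / e) = 2 * pi * normal_density 0 e s"
  proof -
    have "sqrt (2 * pi * e\<^sup>2) = sqrt (2 * pi) * e" using assms by (simp add: real_sqrt_mult)
    moreover have "2 * pi = sqrt (2 * pi) * sqrt (2 * pi)" by simp
    ultimately show ?thesis using assms
      unfolding normal_density_def by (simp add: field_simps power_divide del: real_sqrt_mult_self)
  qed
  show ?eq unfolding * r ..
qed

text \<open>
  The squared transform is first integrated against a Gaussian weight, where Fubini applies because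
  \<open>F\<close> is bounded and the weight integrable. Exchanging the integrals leaves the quadratic form
  \<open>\<integral>\<integral> g s cnj (g t) k (t - s) ds dt\<close> with the Gaussian transform \<open>k\<close> as kernel. The estimate
  \<open>|g s| |g t| \<le> (|g s|^2 + |g t|^2) / 2\<close> and the mass \<open>2\<pi>\<close> of \<open>k\<close> bound it by \<open>2\<pi> \<integral> |g|^2\<close>,
  uniformly in the width of the weight, and Fatou's lemma removes the weight.
\<close>
theorem plancherel_le:
  fixes g :: "real \<Rightarrow> complex"
  assumes g: "integrable lborel g"
  defines "F \<equiv> \<lambda>x. CLINT t|lborel. g t * cis (- (t * x))"
  shows "(\<integral>\<^sup>+x. ennreal ((norm (F x))\<^sup>2) \<partial>lborel) \<le> 2 * pi * (\<integral>\<^sup>+t. ennreal ((norm (g t))\<^sup>2) \<partial>lborel)"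
proof -
  have gm [measurable]: "g \<in> borel_measurable borel"
    using g by auto
  have Fm [measurable]: "F \<in> borel_measurable borel"
    unfolding F_def by measurable
  have F_bound: "norm (F x) \<le> (LINT t|lborel. norm (g t))" for x
    unfolding F_def by (rule order.trans[OF integral_norm_bound]) (simp add: norm_mult)
  let ?G = "\<integral>\<^sup>+t. ennreal ((norm (g t))\<^sup>2) \<partial>lborel"
  have weighted: "(\<integral>\<^sup>+x. ennreal ((norm (F x))\<^sup>2 * exp (- (e * x)\<^sup>2 / 2)) \<partial>lborel) \<le> 2 * pi * ?G"
    if e: "0 < e" for e :: real
  proof -
    define w where "w x = exp (- (e * x)\<^sup>2 / 2)" for x :: real
    define k where "k s = 2 * pi * normal_density 0 e s" for s
    have wm [measurable]: "w \<in> borel_measurable borel" unfolding w_def by measurable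
    have km [measurable]: "k \<in> borel_measurable borel" unfolding k_def by measurable
    have k_nonneg: "k s \<ge> 0" for s by (simp add: k_def)
    have w_nonneg: "w s \<ge> 0" for s by (simp add: w_def)
    have wint: "integrable lborel w"
      using gaussian_fourier(1)[OF e] by (simp add: w_def [abs_def])
    have wint': "integrable lborel (\<lambda>x. complex_of_real (w x))"
      using wint by simp
    have k_eq: "(CLINT x|lborel. cis (s * x) * w x) = k s" for s
      using gaussian_fourier(2)[OF e, of s] by (simp add: w_def k_def)
    have Kint: "integrable lborel (\<lambda>x. cnj (F x) * w x)"
      by (rule Bochner_Integration.integrable_bound[OF integrable_mult_right[OF wint, of "LINT t|lborel. norm (g t)"]])
         (auto simp: norm_mult w_nonneg intro!: AE_I2 mult_mono order.trans[OF F_bound])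
    have cg: "integrable lborel (\<lambda>t. cnj (g t))" using g by simp
    \<comment> \<open>The inner integral of the quadratic form: the phases of the two transforms combine
      to the frequency difference.\<close>
    have inner: "(CLINT x|lborel. cis (- (s * x)) * (cnj (F x) * w x))
        = (CLINT t|lborel. cnj (g t) * k (t - s))" for s
    proof -
      have "(CLINT x|lborel. cis (- (s * x)) * (cnj (F x) * w x)) =
        (CLINT x|lborel. (CLINT t|lborel. cnj (g t) * (cis (t * x) * cis (- (s * x)))) * w x)"
      proof (intro Bochner_Integration.integral_cong refl)
        fix x
        have "cnj (F x) = (CLINT t|lborel. cnj (g t) * cis (t * x))"
          unfolding F_def using Bochner_Integration.integral_cnj[of lborel "\<lambda>t. g t * cis (- (t * x))"]
          by (simp add: cis_cnj)
        then show "cis (- (s * x)) * (cnj (F x) * w x) =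
          (CLINT t|lborel. cnj (g t) * (cis (t * x) * cis (- (s * x)))) * w x"
          by (simp flip: mult.assoc)
      qed
      also have "\<dots> = (CLINT t|lborel. cnj (g t) * (CLINT x|lborel. (cis (t * x) * cis (- (s * x))) * w x))"
        by (rule integral_swap_bounded_kernel[OF cg wint']) (auto simp: norm_mult)
      also have "\<dots> = (CLINT t|lborel. cnj (g t) * k (t - s))"
        by (simp add: cis_mult left_diff_distrib flip: k_eq)
      finally show ?thesis .
    qed
    have "complex_of_real (LINT x|lborel. (norm (F x))\<^sup>2 * w x) = (CLINT x|lborel. F x * (cnj (F x) * w x))"
      unfolding integral_complex_of_real [symmetric]
      by (intro Bochner_Integration.integral_cong refl)
         (simp only: of_real_mult complex_norm_square mult.assoc)
    also have "\<dots> = (CLINT s|lborel. g s * (CLINT x|lborel. cis (- (s * x)) * (cnj (F x) * w x)))"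
    proof -
      have "(\<lambda>(s, x). cis (- (s * x))) \<in> borel_measurable (borel \<Otimes>\<^sub>M borel)" by measurable
      from integral_swap_bounded_kernel[OF g Kint this]
      show ?thesis unfolding F_def by simp
    qed
    also have "\<dots> = (CLINT s|lborel. g s * (CLINT t|lborel. cnj (g t) * k (t - s)))"
      by (simp add: inner)
    finally have eq: "complex_of_real (LINT x|lborel. (norm (F x))\<^sup>2 * w x) =
      (CLINT s|lborel. g s * (CLINT t|lborel. cnj (g t) * k (t - s)))" .
    have F2int: "integrable lborel (\<lambda>x. (norm (F x))\<^sup>2 * w x)"
      by (rule Bochner_Integration.integrable_bound[OF integrable_mult_right[OF wint, of "(LINT t|lborel. norm (g t))\<^sup>2"]])
         (auto simp: norm_mult w_nonneg intro!: AE_I2 mult_right_mono power_mono F_bound)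
    have norm_le: "ennreal (norm (LINT x|lborel. h x)) \<le> (\<integral>\<^sup>+x. ennreal (norm (h x)) \<partial>lborel)" for h :: "real \<Rightarrow> complex"
      by (cases "integrable lborel h") (simp_all add: integral_norm_bound_ennreal not_integrable_integral_eq)
    have "(\<integral>\<^sup>+x. ennreal ((norm (F x))\<^sup>2 * w x) \<partial>lborel) = ennreal (LINT x|lborel. (norm (F x))\<^sup>2 * w x)"
      by (intro nn_integral_eq_integral F2int) (auto simp: w_nonneg)
    also have "\<dots> = ennreal (norm (CLINT s|lborel. g s * (CLINT t|lborel. cnj (g t) * k (t - s))))"
    proof -
      have "0 \<le> (LINT x|lborel. (norm (F x))\<^sup>2 * w x)"
        by (intro integral_nonneg_AE) (auto simp: w_nonneg)
      then show ?thesis by (simp only: eq [symmetric] norm_of_real abs_of_nonneg)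
    qed
    also have "\<dots> \<le> (\<integral>\<^sup>+s. ennreal (norm (g s * (CLINT t|lborel. cnj (g t) * k (t - s)))) \<partial>lborel)"
      by (rule norm_le)
    also have "\<dots> \<le> (\<integral>\<^sup>+s. \<integral>\<^sup>+t. ennreal (norm (g s) * norm (g t) * k (t - s)) \<partial>lborel \<partial>lborel)"
    proof (intro nn_integral_mono)
      fix s
      have "ennreal (norm (g s * (CLINT t|lborel. cnj (g t) * k (t - s))))
        \<le> ennreal (norm (g s)) * (\<integral>\<^sup>+t. ennreal (norm (cnj (g t) * k (t - s))) \<partial>lborel)"
        using mult_left_mono[OF norm_le[of "\<lambda>t. cnj (g t) * k (t - s)"], of "ennreal (norm (g s))"]
        by (simp add: norm_mult ennreal_mult)
      also have "\<dots> = (\<integral>\<^sup>+t. ennreal (norm (g s)) * ennreal (norm (cnj (g t) * k (t - s))) \<partial>lborel)"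
        by (subst nn_integral_cmult) auto
      finally show "ennreal (norm (g s * (CLINT t|lborel. cnj (g t) * k (t - s))))
        \<le> (\<integral>\<^sup>+t. ennreal (norm (g s) * norm (g t) * k (t - s)) \<partial>lborel)"
        by (simp add: norm_mult k_nonneg mult.assoc ennreal_mult)
    qed
    \<comment> \<open>The arithmetic-geometric inequality separates the two copies of \<open>g\<close>.\<close>
    also have "\<dots> \<le> (\<integral>\<^sup>+s. \<integral>\<^sup>+t. (ennreal ((norm (g s))\<^sup>2 / 2) * ennreal (k (t - s))
        + ennreal ((norm (g t))\<^sup>2 / 2) * ennreal (k (t - s))) \<partial>lborel \<partial>lborel)"
    proof (intro nn_integral_mono)
      fix s t
      have "norm (g s) * norm (g t) \<le> (norm (g s))\<^sup>2 / 2 + (norm (g t))\<^sup>2 / 2"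
        using sum_squares_bound[of "norm (g s)" "norm (g t)"] by simp
      from mult_right_mono[OF this k_nonneg[of "t - s"]]
      have "ennreal (norm (g s) * norm (g t) * k (t - s))
          \<le> ennreal ((norm (g s))\<^sup>2 / 2 * k (t - s) + (norm (g t))\<^sup>2 / 2 * k (t - s))"
        unfolding distrib_right by (rule ennreal_leI)
      then show "ennreal (norm (g s) * norm (g t) * k (t - s)) \<le>
        ennreal ((norm (g s))\<^sup>2 / 2) * ennreal (k (t - s)) + ennreal ((norm (g t))\<^sup>2 / 2) * ennreal (k (t - s))"
        by (simp only: ennreal_plus ennreal_mult k_nonneg norm_ge_zero zero_le_power divide_nonneg_nonneg
            mult_nonneg_nonneg zero_le_numeral)
    qed
    also have "\<dots> = (\<integral>\<^sup>+s. \<integral>\<^sup>+t. ennreal ((norm (g s))\<^sup>2 / 2) * ennreal (k (t - s)) \<partial>lborel \<partial>lborel)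
       + (\<integral>\<^sup>+s. \<integral>\<^sup>+t. ennreal ((norm (g t))\<^sup>2 / 2) * ennreal (k (t - s)) \<partial>lborel \<partial>lborel)"
      by (simp add: nn_integral_add)
    also have "(\<integral>\<^sup>+s. \<integral>\<^sup>+t. ennreal ((norm (g t))\<^sup>2 / 2) * ennreal (k (t - s)) \<partial>lborel \<partial>lborel)
       = (\<integral>\<^sup>+t. \<integral>\<^sup>+s. ennreal ((norm (g t))\<^sup>2 / 2) * ennreal (k (t - s)) \<partial>lborel \<partial>lborel)"
      by (rule lborel_pair.Fubini') measurable
    finally have le: "(\<integral>\<^sup>+x. ennreal ((norm (F x))\<^sup>2 * w x) \<partial>lborel) \<le>
      (\<integral>\<^sup>+s. ennreal ((norm (g s))\<^sup>2 / 2) * (\<integral>\<^sup>+t. ennreal (k (t - s)) \<partial>lborel) \<partial>lborel)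
      + (\<integral>\<^sup>+t. ennreal ((norm (g t))\<^sup>2 / 2) * (\<integral>\<^sup>+s. ennreal (k (t - s)) \<partial>lborel) \<partial>lborel)"
      by (simp add: nn_integral_cmult)
    have k0: "(\<integral>\<^sup>+t. ennreal (k t) \<partial>lborel) = 2 * pi"
      unfolding k_def using e
      by (simp add: ennreal_mult nn_integral_cmult nn_integral_eq_integral)
    have k1: "(\<integral>\<^sup>+t. ennreal (k (t - s)) \<partial>lborel) = 2 * pi" for s
      using nn_integral_real_affine[of "\<lambda>t. ennreal (k t)" 1 "-s"] k0 by simp
    have k2: "(\<integral>\<^sup>+s. ennreal (k (t - s)) \<partial>lborel) = 2 * pi" for t
      using nn_integral_real_affine[of "\<lambda>t. ennreal (k t)" "-1" t] k0 by simp
    have half: "(\<integral>\<^sup>+s. ennreal ((norm (g s))\<^sup>2 / 2) * ennreal (2 * pi) \<partial>lborel) = pi * ?G"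
    proof -
      have "ennreal (y / 2) * ennreal (2 * pi) = ennreal pi * ennreal y" if "0 \<le> y" for y
        using that by (subst (1 2) ennreal_mult [symmetric]) auto
      then show ?thesis by (simp add: nn_integral_cmult)
    qed
    have "pi * ?G + pi * ?G = 2 * pi * ?G"
    proof -
      have "ennreal (2 * pi) = ennreal pi + ennreal pi"
        by (subst ennreal_plus [symmetric]) auto
      then show ?thesis by (simp only: distrib_right)
    qed
    with le show ?thesis unfolding k1 k2 half w_def by simp
  qed
  \<comment> \<open>Gaussian weights of width \<open>n + 1\<close> increase to the constant 1.\<close>
  define W where "W n x = ennreal ((norm (F x))\<^sup>2 * exp (- (1 / real (Suc n) * x)\<^sup>2 / 2))" for n x
  have lim: "(\<lambda>n. W n x) \<longlonglongrightarrow> ennreal ((norm (F x))\<^sup>2)" for x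
  proof -
    have "(\<lambda>n. 1 / real (Suc n)) \<longlonglongrightarrow> 0" using LIMSEQ_inverse_real_of_nat by (simp add: inverse_eq_divide)
    then have "(\<lambda>n. (norm (F x))\<^sup>2 * exp (- (1 / real (Suc n) * x)\<^sup>2 / 2))
        \<longlonglongrightarrow> (norm (F x))\<^sup>2 * exp (- (0 * x)\<^sup>2 / 2)"
      by (intro tendsto_intros) auto
    then show ?thesis unfolding W_def by (intro tendsto_ennrealI) simp
  qed
  have "(\<integral>\<^sup>+x. ennreal ((norm (F x))\<^sup>2) \<partial>lborel) = (\<integral>\<^sup>+x. liminf (\<lambda>n. W n x) \<partial>lborel)"
    by (intro nn_integral_cong lim_imp_Liminf[OF _ lim, symmetric]) simp
  also have "\<dots> \<le> liminf (\<lambda>n. \<integral>\<^sup>+x. W n x \<partial>lborel)"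
    by (intro nn_integral_liminf) (simp add: W_def)
  also have "\<dots> \<le> 2 * pi * ?G"
  proof (rule Liminf_le)
    show "\<forall>\<^sub>F n in sequentially. (\<integral>\<^sup>+x. W n x \<partial>lborel) \<le> 2 * pi * ?G"
      unfolding W_def by (intro always_eventually allI weighted) simp
  qed simp
  finally show ?thesis .
qed

section \<open>Synthesis from a bounded frequency band\<close>

text \<open>
  The inverse Fourier transform of a weight on \<open>[-a, a]\<close>, with the sign convention under which a
  density is recovered from its characteristic function. The integral is
  a Henstock-Kurzweil integral over a compact interval, so that the Leibniz rule and the exchange of
  integrals for continuous integrands apply.
\<close>
definition band_synthesis :: "real \<Rightarrow> (real \<Rightarrow> complex) \<Rightarrow> real \<Rightarrow> complex" where
  "band_synthesis a g x = 1 / (2 * pi) * integral {-a..a} (\<lambda>t. g t * cis (- (t * x)))"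

text \<open>
  The multiplier \<open>(-it)^r\<close> is the Fourier side of the \<open>r\<close>-th derivative.
\<close>
lemma continuous_on_frequency_power [continuous_intros]:
  fixes g :: "real \<Rightarrow> complex"
  shows "continuous_on S g \<Longrightarrow> continuous_on S (\<lambda>t. (- \<i> * complex_of_real t) ^ r * g t)"
  by (intro continuous_intros)

lemma band_synthesis_has_vector_derivative:
  assumes "continuous_on {-a..a} g"
  shows "(band_synthesis a g has_vector_derivative band_synthesis a (\<lambda>t. - \<i> * t * g t) x) (at x)"
proof -
  have "((\<lambda>x. integral (cbox (-a) a) (\<lambda>t. g t * cis (- (t * x)))) has_vector_derivative
      integral (cbox (-a) a) (\<lambda>t. - \<i> * t * g t * cis (- (t * x)))) (at x within UNIV)"
  proof (rule leibniz_rule_vector_derivative)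
    show "((\<lambda>x. g t * cis (- (t * x))) has_vector_derivative - \<i> * t * g t * cis (- (t * x))) (at x within UNIV)" for x t
      by (auto intro!: derivative_eq_intros simp: has_vector_derivative_def scaleR_conv_of_real)
    show "(\<lambda>t. g t * cis (- (t * x))) integrable_on cbox (- a) a" for x
      using assms by (intro integrable_continuous continuous_intros) auto
    have "continuous_on (UNIV \<times> {-a..a}) (\<lambda>z :: real \<times> real. g (snd z))"
      by (rule continuous_on_compose2[OF assms]) (auto intro!: continuous_intros)
    then show "continuous_on (UNIV \<times> cbox (- a) a) (\<lambda>(x, t). - \<i> * complex_of_real t * g t * cis (- (t * x)))"
      unfolding split_beta by (intro continuous_intros) auto
  qed auto
  then show ?thesis
    unfolding band_synthesis_def [abs_def]
    by (intro has_vector_derivative_mult_right) simp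
qed

lemma deriv_Re_band_synthesis:
  assumes "continuous_on {-a..a} g"
  shows "deriv (\<lambda>x. Re (band_synthesis a g x)) = (\<lambda>x. Re (band_synthesis a (\<lambda>t. - \<i> * t * g t) x))"
proof
  fix x
  have "((\<lambda>x. Re (band_synthesis a g x)) has_real_derivative Re (band_synthesis a (\<lambda>t. - \<i> * t * g t) x)) (at x)"
    using bounded_linear.has_vector_derivative[OF bounded_linear_Re band_synthesis_has_vector_derivative[OF assms]]
    by (simp add: has_real_derivative_iff_has_vector_derivative)
  then show "deriv (\<lambda>x. Re (band_synthesis a g x)) x = Re (band_synthesis a (\<lambda>t. - \<i> * t * g t) x)"
    by (rule DERIV_imp_deriv)
qed

text \<open>
  Each differentiation of \<open>e^(-itx)\<close> in \<open>x\<close> brings down a factor \<open>-it\<close>. The band is compact and the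
  weight continuous, so this holds for every order.
\<close>
lemma higher_deriv_Re_band_synthesis:
  assumes "continuous_on {-a..a} g"
  shows "(deriv ^^ r) (\<lambda>x. Re (band_synthesis a g x)) =
    (\<lambda>x. Re (band_synthesis a (\<lambda>t. (- \<i> * t) ^ r * g t) x))"
proof (induction r)
  case (Suc r)
  show ?case
    using deriv_Re_band_synthesis[OF continuous_on_frequency_power[OF assms, of r]]
    by (simp add: Suc mult.assoc del: mult_minus_left)
qed simp

lemma band_synthesis_diff:
  assumes "continuous_on {-a..a} g" "continuous_on {-a..a} g'"
  shows "band_synthesis a (\<lambda>t. g t - g' t) x = band_synthesis a g x - band_synthesis a g' x"
  unfolding band_synthesis_def left_diff_distrib
  using assms by (subst integral_diff)
    (auto intro!: integrable_continuous_real continuous_intros simp: right_diff_distrib)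

lemma integral_cos_symmetric:
  fixes a u :: real
  assumes "0 \<le> a"
  shows "integral {-a..a} (\<lambda>t. cos (t * u)) = (if u = 0 then 2 * a else 2 * sin (a * u) / u)"
proof (cases "u = 0")
  case False
  have "((\<lambda>t. cos (t * u)) has_integral sin (a * u) / u - sin (- a * u) / u) {-a..a}"
  proof (rule fundamental_theorem_of_calculus[where f = "\<lambda>t. sin (t * u) / u"])
    show "((\<lambda>t. sin (t * u) / u) has_vector_derivative cos (t * u)) (at t within {-a..a})" for t
      unfolding has_real_derivative_iff_has_vector_derivative [symmetric]
      using False by (auto intro!: derivative_eq_intros)
  qed (use assms in simp)
  with False show ?thesis by (simp add: integral_unique)
qed (use assms in simp)

lemma sinc_kernel_eq_integral_cos:
  assumes "0 < h"
  shows "1 / h * sinc_kernel (u / h) = 1 / (2 * pi) * integral {-(1/h)..1/h} (\<lambda>t. cos (t * u))"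
proof -
  have "0 \<le> 1 / h" using assms by simp
  from integral_cos_symmetric[OF this, of u] show ?thesis
    using assms by (cases "u = 0") (simp_all add: sinc_kernel_def)
qed

text \<open>
  The rescaled sinc kernel is the transform of the indicator of \<open>[-1/h, 1/h]\<close>; moving its centre to
  the observation \<open>y\<close> multiplies the indicator by \<open>e^(ity)\<close>, the characteristic function of the point
  mass at \<open>y\<close>.
\<close>
lemma sinc_kernel_eq_band_synthesis:
  assumes "0 < h"
  shows "1 / h * sinc_kernel ((x - y) / h) = Re (band_synthesis (1 / h) (\<lambda>t. cis (t * y)) x)"
proof -
  have Re_eq: "Re (cis (t * y) * cis (- (t * x))) = cos (t * (x - y))" for t
  proof -
    have "t * y + - (t * x) = - (t * (x - y))" by (simp add: algebra_simps)
    then show ?thesis by (simp only: cis_mult cis.sel cos_minus)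
  qed
  have "(\<lambda>t. cis (t * y) * cis (- (t * x))) integrable_on {-(1/h)..1/h}"
    by (intro integrable_continuous_real continuous_intros)
  from integral_linear[OF this bounded_linear_Re]
  have "Re (integral {-(1/h)..1/h} (\<lambda>t. cis (t * y) * cis (- (t * x))))
     = integral {-(1/h)..1/h} (\<lambda>t. cos (t * (x - y)))"
    unfolding o_def Re_eq by (rule sym)
  then show ?thesis
    unfolding sinc_kernel_eq_integral_cos[OF assms] by (simp add: band_synthesis_def)
qed

text \<open>
  By linearity the estimator is synthesised from the empirical characteristic function.
\<close>
lemma sinc_estimator_eq_band_synthesis:
  assumes "0 < h"
  shows "sinc_estimator n xs h x =
    Re (band_synthesis (1 / h) (\<lambda>t. (\<Sum>j = 1..n. cis (t * xs j)) / n) x)"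
proof -
  have *: "integral {-(1/h)..1/h} (\<lambda>t. (\<Sum>j = 1..n. cis (t * xs j)) / n * cis (- (t * x)))
    = (\<Sum>j = 1..n. integral {-(1/h)..1/h} (\<lambda>t. cis (t * xs j) * cis (- (t * x)))) / n"
    by (simp add: sum_distrib_right sum_divide_distrib)
       (subst integral_sum, auto intro!: integrable_continuous_real continuous_intros)
  have "Re (band_synthesis (1 / h) (\<lambda>t. (\<Sum>j = 1..n. cis (t * xs j)) / n) x)
     = (\<Sum>j = 1..n. Re (band_synthesis (1 / h) (\<lambda>t. cis (t * xs j)) x)) / n"
    unfolding band_synthesis_def * by (simp add: sum_divide_distrib mult.commute)
  also have "\<dots> = (\<Sum>j = 1..n. 1 / h * sinc_kernel ((x - xs j) / h)) / n"
    using sinc_kernel_eq_band_synthesis[OF assms] by simp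
  finally show ?thesis
    by (simp add: sinc_estimator_def sum_divide_distrib sum_distrib_left mult.commute)
qed

section \<open>Inversion for band-limited densities\<close>

text \<open>
  Half-open intervals generate the Borel sets and are closed under intersection, so a density is
  determined almost everywhere by its integrals over them. The pointwise sign of \<open>p\<close> is unknown at
  this stage; adding the constant \<open>C\<close> to both functions makes them densities of measures that can be
  compared.
\<close>
lemma AE_eq_if_interval_integrals_eq:
  fixes f p :: "real \<Rightarrow> real"
  assumes f [measurable]: "f \<in> borel_measurable borel" and f_nonneg: "\<And>x. f x \<ge> 0"
    and p: "continuous_on UNIV p" and p_le: "\<And>x. \<bar>p x\<bar> \<le> C"
    and eq: "\<And>a b. a \<le> b \<Longrightarrow> (\<integral>\<^sup>+x. ennreal (f x) * indicator {a<..b} x \<partial>lborel) = ennreal (integral {a..b} p)"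
    and nonneg: "\<And>a b. a \<le> b \<Longrightarrow> integral {a..b} p \<ge> 0"
  shows "AE x in lborel. f x = p x"
proof -
  have C: "C \<ge> 0" using p_le[of 0] by simp
  have pm [measurable]: "p \<in> borel_measurable borel"
    using p by (rule borel_measurable_continuous_onI)
  have pC: "p x + C \<ge> 0" for x using p_le[of x] by simp
  let ?F = "density lborel (\<lambda>x. ennreal (f x + C))"
  let ?P = "density lborel (\<lambda>x. ennreal (p x + C))"
  have Ioc: "emeasure ?F {a<..b} = ennreal (integral {a..b} p + C * (b - a))"
    "emeasure ?P {a<..b} = ennreal (integral {a..b} p + C * (b - a))" if "a \<le> b" for a b
  proof -
    have "emeasure ?F {a<..b} = (\<integral>\<^sup>+x. (ennreal (f x) * indicator {a<..b} x + ennreal C * indicator {a<..b} x) \<partial>lborel)"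
      using C f_nonneg by (simp add: emeasure_density distrib_right)
    also have "\<dots> = ennreal (integral {a..b} p) + ennreal C * ennreal (b - a)"
      using that by (simp add: nn_integral_add nn_integral_cmult eq)
    finally show "emeasure ?F {a<..b} = ennreal (integral {a..b} p + C * (b - a))"
      using that C nonneg[OF that] by (simp add: ennreal_mult)
    have "((\<lambda>x. p x + C) has_integral (integral {a..b} p + C * (b - a))) {a..b}"
      using that has_integral_const_real[of C a b] p
      by (intro has_integral_add integrable_integral integrable_continuous_real)
         (auto simp: mult.commute intro: continuous_on_subset)
    then have "(\<integral>\<^sup>+x. ennreal (p x + C) * indicator {a..b} x \<partial>lborel) = ennreal (integral {a..b} p + C * (b - a))"
      using pC by (intro nn_integral_has_integral_lebesgue') auto
    moreover have "(\<integral>\<^sup>+x. ennreal (p x + C) * indicator {a..b} x \<partial>lborel)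
        = (\<integral>\<^sup>+x. ennreal (p x + C) * indicator {a<..b} x \<partial>lborel)"
      using AE_lborel_singleton[of a] by (intro nn_integral_cong_AE) (auto split: split_indicator)
    ultimately show "emeasure ?P {a<..b} = ennreal (integral {a..b} p + C * (b - a))"
      by (simp add: emeasure_density)
  qed
  have "?F = ?P"
  proof (rule measure_eqI_generator_eq)
    let ?E = "range (\<lambda>(a, b). {a<..b::real})"
    show "Int_stable ?E"
    proof (rule Int_stableI)
      fix A B assume "A \<in> ?E" "B \<in> ?E"
      then obtain a b c d where "A = {a<..b}" "B = {c<..d}" by auto
      then have "A \<inter> B = (\<lambda>(a, b). {a<..b}) (max a c, min b d)" by auto
      then show "A \<inter> B \<in> ?E" by blast
    qed
    show "?E \<subseteq> Pow UNIV" by simp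
    show "sets ?F = sigma_sets UNIV ?E" "sets ?P = sigma_sets UNIV ?E"
      by (auto simp: borel_sigma_sets_Ioc)
    show "emeasure ?F A = emeasure ?P A" if "A \<in> ?E" for A
    proof -
      from that obtain a b where A: "A = {a<..b}" by auto
      show ?thesis
        by (cases "a \<le> b") (simp_all add: A Ioc)
    qed
    show "range (\<lambda>n::nat. {- real n<..real n}) \<subseteq> ?E" by auto
    show "(\<Union>n::nat. {- real n<..real n}) = UNIV"
    proof (intro set_eqI iffI UNIV_I)
      fix x :: real
      obtain n where "\<bar>x\<bar> < real n" using reals_Archimedean2 by blast
      then show "x \<in> (\<Union>n::nat. {- real n<..real n})" by (intro UN_I[of n]) auto
    qed
    show "emeasure ?F {- real n<..real n} \<noteq> \<infinity>" for n
      by (subst Ioc(1)) auto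
  qed
  then have "AE x in lborel. ennreal (f x + C) = ennreal (p x + C)"
    by (intro sigma_finite_measure.density_unique sigma_finite_lborel) auto
  then show ?thesis
  proof eventually_elim
    case (elim x)
    then have "f x + C = p x + C"
      using f_nonneg[of x] C pC[of x] by (subst (asm) ennreal_inj) auto
    then show ?case by simp
  qed
qed

lemma continuous_band_synthesis:
  assumes "continuous_on {-a..a} g"
  shows "continuous_on S (band_synthesis a g)"
  by (intro continuous_at_imp_continuous_on ballI
      has_vector_derivative_continuous[OF band_synthesis_has_vector_derivative[OF assms]])

lemma norm_band_synthesis_le:
  assumes "continuous_on {-a..a} g"
  shows "norm (band_synthesis a g x) \<le> 1 / (2 * pi) * integral {-a..a} (\<lambda>t. norm (g t))"
proof -
  have "norm (integral {-a..a} (\<lambda>t. g t * cis (- (t * x)))) \<le> integral {-a..a} (\<lambda>t. norm (g t))"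
    using assms by (intro integral_norm_bound_integral integrable_continuous_real continuous_intros)
      (auto simp: norm_mult)
  then show ?thesis
    unfolding band_synthesis_def by (simp add: norm_mult norm_divide divide_right_mono)
qed

text \<open>
  The kernel of Levy's inversion formula is an integral of characters over the interval.
\<close>
lemma integral_cis:
  assumes "t \<noteq> 0" "x \<le> y"
  shows "integral {x..y} (\<lambda>s. cis (- (t * s))) = (iexp (- (t * x)) - iexp (- (t * y))) / (\<i> * t)"
proof -
  have ii: "\<i> * (z * \<i>) = - z" for z
    by (simp add: mult.commute[of z] flip: mult.assoc)
  have I: "((\<lambda>s. cis (- (t * s))) has_integral cis (- (t * y)) * (\<i> / t) - cis (- (t * x)) * (\<i> / t)) {x..y}"
    using assms
    by (intro fundamental_theorem_of_calculus[where f = "\<lambda>s. cis (- (t * s)) * (\<i> / t)"])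
       (auto intro!: derivative_eq_intros simp: has_vector_derivative_def scaleR_conv_of_real ii)
  have "z / (\<i> * t) = - (z * (\<i> / t))" for z
    using assms by (simp add: divide_simps ii)
  then show ?thesis
    unfolding integral_unique[OF I] cis_conv_exp [symmetric] by (simp add: left_diff_distrib diff_divide_distrib)
qed

text \<open>
  Levy's inversion formula expresses the measure of an interval as a limit of truncated frequency
  integrals. For a band-limited characteristic function the truncations are eventually constant, so no
  limit remains; the Levy kernel is then written as an integral over the interval and the order of
  integration is exchanged.
\<close>
lemma (in real_distribution) measure_Ioc_eq_integral_band_synthesis:
  assumes zero: "\<And>t. \<bar>t\<bar> > a \<Longrightarrow> char M t = 0" and a: "0 \<le> a" and xy: "x \<le> y"
    and atoms: "measure M {x} = 0" "measure M {y} = 0"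
  shows "complex_of_real (measure M {x<..y}) = integral {x..y} (band_synthesis a (char M))"
proof -
  let ?L = "\<lambda>t. (iexp (- (t * x)) - iexp (- (t * y))) / (\<i> * t) * char M t"
  define J where "J t = char M t * integral {x..y} (\<lambda>s. cis (- (t * s)))" for t
  have char_cont: "continuous_on S (char M)" for S
    by (intro continuous_at_imp_continuous_on ballI isCont_char)
  \<comment> \<open>The quotient is singular at \<open>t = 0\<close>; \<open>J\<close> is the continuous extension of the integrand.\<close>
  have J_eq: "J t = ?L t" if "t \<noteq> 0" for t
    using integral_cis[OF that xy] by (simp add: J_def)
  have J_cont: "continuous_on S J" for S
  proof -
    have "continuous_on UNIV (\<lambda>t. integral (cbox x y) (\<lambda>s. cis (- (t * s))))"
      by (intro integral_continuous_on_param) (auto simp: split_beta intro!: continuous_intros)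
    then show ?thesis unfolding J_def
      by (intro continuous_intros char_cont) (auto intro: continuous_on_subset)
  qed
  have L_eq: "(CLBINT t=ereal (-U)..ereal U. ?L t) = integral {-a..a} J" if "a \<le> U" for U :: real
  proof -
    have "(CLBINT t=ereal (-U)..ereal U. ?L t) = (CLBINT t=ereal (-U)..ereal U. J t)"
      using AE_lborel_singleton[of "0::real"] a that borel_measurable_continuous_onI[OF J_cont]
      by (intro interval_integral_cong_AE) (auto simp: J_eq)
    also have "\<dots> = integral {-U..U} J"
      using a that by (intro interval_integral_eq_integral) (auto intro!: borel_integrable_atLeastAtMost' J_cont)
    also have "\<dots> = integral {-a..a} J"
    proof -
      have J_if: "J = (\<lambda>t. if t \<in> {-a..a} then J t else 0)"
      proof
        fix t
        show "J t = (if t \<in> {-a..a} then J t else 0)"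
        proof (cases "t \<in> {-a..a}")
          case False
          then have "\<bar>t\<bar> > a" by auto
          from zero[OF this] False show ?thesis unfolding J_def by simp
        qed simp
      qed
      have inter: "{-a..a} \<inter> {-U..U} = {-a..a}"
        using that by auto
      have "integral {-U..U} J = integral {-U..U} (\<lambda>t. if t \<in> {-a..a} then J t else 0)"
        by (rule arg_cong[OF J_if])
      also have "\<dots> = integral ({-a..a} \<inter> {-U..U}) J"
        by (rule Henstock_Kurzweil_Integration.integral_restrict_Int)
      finally show ?thesis
        by (simp only: inter)
    qed
    finally show ?thesis .
  qed
  define c where "c = complex_of_real (1 / (2 * pi))"
  have "(\<lambda>U::nat. c * (CLBINT t=ereal (- real U)..ereal (real U). ?L t)) \<longlonglongrightarrow> complex_of_real (measure M {x<..y})"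
    using Levy_Inversion[OF xy atoms] unfolding c_def of_int_minus of_int_of_nat_eq .
  moreover have "\<forall>\<^sub>F U::nat in sequentially. c * (CLBINT t=ereal (- real U)..ereal (real U). ?L t) = c * integral {-a..a} J"
    using eventually_ge_at_top[of "nat \<lceil>a\<rceil>"]
  proof eventually_elim
    case (elim U)
    then have "a \<le> real U" by linarith
    then show ?case by (simp only: L_eq)
  qed
  ultimately have "complex_of_real (measure M {x<..y}) = c * integral {-a..a} J"
    by (rule LIMSEQ_unique[OF _ tendsto_eventually])
  also have "integral {-a..a} J = integral {x..y} (\<lambda>s. integral {-a..a} (\<lambda>t. char M t * cis (- (t * s))))"
  proof -
    have "continuous_on (cbox (-a, x) (a, y)) (\<lambda>(t, s). char M t * cis (- (t * s)))"
      unfolding split_beta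
      by (intro continuous_intros continuous_on_compose2[OF char_cont[of UNIV]]) auto
    from integral_swap_continuous[OF this] show ?thesis
      by (simp add: J_def [abs_def])
  qed
  finally show ?thesis
    unfolding band_synthesis_def c_def by simp
qed

text \<open>
  A distribution with a density has no atoms, so its measure of every interval is known from the
  characteristic function, and these values determine the density up to a null set.
\<close>
theorem density_eq_band_synthesis_AE:
  assumes f [measurable]: "f \<in> borel_measurable borel" and f_nonneg: "\<And>x. f x \<ge> 0"
    and M: "M = density lborel (\<lambda>x. ennreal (f x))" and prob: "prob_space M"
    and zero: "\<And>t. \<bar>t\<bar> > a \<Longrightarrow> char M t = 0" and a: "0 \<le> a"
  shows "AE x in lborel. f x = Re (band_synthesis a (char M) x)"
proof -
  interpret real_distribution M
    using prob by (simp add: M real_distribution_def real_distribution_axioms_def)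
  let ?B = "band_synthesis a (char M)"
  have char_cont: "continuous_on S (char M)" for S
    by (intro continuous_at_imp_continuous_on ballI isCont_char)
  have point: "measure M {x} = 0" for x
  proof -
    have "emeasure M {x} = (\<integral>\<^sup>+y. ennreal (f y) * indicator {x} y \<partial>lborel)"
      by (simp add: M emeasure_density)
    also have "\<dots> = 0"
      using AE_lborel_singleton[of x] by (subst nn_integral_0_iff_AE) (auto elim!: eventually_mono)
    finally show ?thesis by (simp add: measure_def)
  qed
  have Re_eq: "measure M {x<..y} = integral {x..y} (\<lambda>s. Re (?B s))" if "x \<le> y" for x y
  proof -
    have "measure M {x<..y} = Re (integral {x..y} ?B)"
      using measure_Ioc_eq_integral_band_synthesis[OF zero a that point point]
      by (metis Re_complex_of_real)
    also have "\<dots> = integral {x..y} (Re \<circ> ?B)"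
      by (intro integral_linear[symmetric] bounded_linear_Re integrable_continuous_real
          continuous_band_synthesis char_cont)
    finally show ?thesis by (simp add: o_def)
  qed
  show ?thesis
  proof (rule AE_eq_if_interval_integrals_eq)
    show "continuous_on UNIV (\<lambda>x. Re (?B x))"
      by (intro continuous_intros continuous_band_synthesis char_cont)
    show "\<bar>Re (?B x)\<bar> \<le> 1 / (2 * pi) * integral {-a..a} (\<lambda>t. norm (char M t))" for x
      using abs_Re_le_cmod norm_band_synthesis_le[OF char_cont] by (rule order.trans)
    show "(\<integral>\<^sup>+x. ennreal (f x) * indicator {x'<..y} x \<partial>lborel) = ennreal (integral {x'..y} (\<lambda>s. Re (?B s)))"
      if "x' \<le> y" for x' y
      using emeasure_eq_measure[of "{x'<..y}"] unfolding Re_eq[OF that]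
      by (simp add: M emeasure_density)
    show "0 \<le> integral {x..y} (\<lambda>s. Re (?B s))" if "x \<le> y" for x y
      unfolding Re_eq[OF that, symmetric] by simp
  qed (use f_nonneg in auto)
qed

section \<open>The mean square error of the empirical characteristic function\<close>

text \<open>
  The complex form of additivity of variance: in the expansion of the squared modulus the mixed terms
  \<open>Z i\<close> times the conjugate of \<open>Z j\<close> have mean zero by independence.
\<close>
lemma (in prob_space) expectation_norm_sum_indep_centered:
  fixes Z :: "'i \<Rightarrow> 'a \<Rightarrow> complex"
  assumes fin: "finite I" and ind: "indep_vars (\<lambda>_. borel) Z I"
    and int: "\<And>i. i \<in> I \<Longrightarrow> integrable M (Z i)"
    and sq: "\<And>i. i \<in> I \<Longrightarrow> integrable M (\<lambda>\<omega>. (norm (Z i \<omega>))\<^sup>2)"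
    and centered: "\<And>i. i \<in> I \<Longrightarrow> (CLINT \<omega>|M. Z i \<omega>) = 0"
  shows "expectation (\<lambda>\<omega>. (norm (\<Sum>i\<in>I. Z i \<omega>))\<^sup>2) = (\<Sum>i\<in>I. expectation (\<lambda>\<omega>. (norm (Z i \<omega>))\<^sup>2))"
proof -
  have cross: "integrable M (\<lambda>\<omega>. Z i \<omega> * cnj (Z j \<omega>)) \<and>
      (CLINT \<omega>|M. Z i \<omega> * cnj (Z j \<omega>)) = (if i = j then complex_of_real (expectation (\<lambda>\<omega>. (norm (Z i \<omega>))\<^sup>2)) else 0)"
    if ij: "i \<in> I" "j \<in> I" for i j
  proof (cases "i = j")
    case True
    have "(\<lambda>\<omega>. Z i \<omega> * cnj (Z j \<omega>)) = (\<lambda>\<omega>. complex_of_real ((norm (Z i \<omega>))\<^sup>2))"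
      unfolding True by (intro ext, subst complex_norm_square, rule refl)
    with sq[OF ij(1)] True show ?thesis by (simp del: of_real_power)
  next
    case False
    \<comment> \<open>Conjugating only the second factor keeps the pair independent, so the mean of the product
      splits.\<close>
    define Y where "Y k = (if k = i then (\<lambda>z. z) else cnj)" for k
    have "indep_vars (\<lambda>_. borel) (\<lambda>k \<omega>. Y k (Z k \<omega>)) {i, j}"
      using ij by (intro indep_vars_compose2[OF indep_vars_subset[OF ind]])
        (auto simp: Y_def intro!: borel_measurable_continuous_onI continuous_intros)
    moreover have "integrable M (\<lambda>\<omega>. Y k (Z k \<omega>))" if "k \<in> {i, j}" for k
      using that ij int by (auto simp: Y_def)
    ultimately have
      "(CLINT \<omega>|M. (\<Prod>k\<in>{i, j}. Y k (Z k \<omega>))) = (\<Prod>k\<in>{i, j}. CLINT \<omega>|M. Y k (Z k \<omega>))"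
      "integrable M (\<lambda>\<omega>. \<Prod>k\<in>{i, j}. Y k (Z k \<omega>))"
      by (intro indep_vars_lebesgue_integral indep_vars_integrable; simp)+
    with False ij centered show ?thesis by (simp add: Y_def)
  qed
  have "complex_of_real (expectation (\<lambda>\<omega>. (norm (\<Sum>i\<in>I. Z i \<omega>))\<^sup>2))
      = (CLINT \<omega>|M. (\<Sum>i\<in>I. \<Sum>j\<in>I. Z i \<omega> * cnj (Z j \<omega>)))"
    unfolding integral_complex_of_real [symmetric] complex_norm_square cnj_sum sum_product ..
  also have "\<dots> = (\<Sum>i\<in>I. \<Sum>j\<in>I. CLINT \<omega>|M. Z i \<omega> * cnj (Z j \<omega>))"
    using cross by (simp add: Bochner_Integration.integral_sum)
  also have "\<dots> = complex_of_real (\<Sum>i\<in>I. expectation (\<lambda>\<omega>. (norm (Z i \<omega>))\<^sup>2))"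
    using cross fin by simp
  finally show ?thesis by (simp only: of_real_eq_iff)
qed

text \<open>
  For each frequency \<open>t\<close> the empirical characteristic function is an average of \<open>n\<close> independent
  variables of modulus one with mean \<open>\<phi> t\<close>; each has variance \<open>1 - |\<phi> t|^2 \<le> 1\<close>.
\<close>
lemma (in prob_space) empirical_char_mean_square_error_le:
  fixes n :: nat and X :: "nat \<Rightarrow> 'a \<Rightarrow> real"
  assumes n: "n \<ge> 1" and ind: "indep_vars (\<lambda>_. borel) X {1..n}"
    and char: "\<And>j. j \<in> {1..n} \<Longrightarrow> \<phi> = char (distr M borel (X j))"
  shows "(\<integral>\<^sup>+\<omega>. ennreal ((norm ((\<Sum>j = 1..n. cis (t * X j \<omega>)) / n - \<phi> t))\<^sup>2) \<partial>M) \<le> ennreal (1 / n)"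
proof -
  define Z where "Z j \<omega> = cis (t * X j \<omega>) - \<phi> t" for j \<omega>
  have X [measurable]: "X j \<in> borel_measurable M" if "j \<in> {1..n}" for j
    using ind that by (auto simp: indep_vars_def)
  have cint: "integrable M (\<lambda>\<omega>. cis (t * X j \<omega>))" if "j \<in> {1..n}" for j
    using that by (intro integrable_const_bound[of _ 1]) auto
  have mean: "(CLINT \<omega>|M. cis (t * X j \<omega>)) = \<phi> t" if "j \<in> {1..n}" for j
    unfolding char[OF that] char_def using that
    by (subst integral_distr) (auto simp: cis_conv_exp)
  have \<phi>_le: "norm (\<phi> t) \<le> 1"
  proof -
    have "norm (\<phi> t) \<le> expectation (\<lambda>\<omega>. norm (cis (t * X 1 \<omega>)))"
      using n mean[of 1] integral_norm_bound[of M "\<lambda>\<omega>. cis (t * X 1 \<omega>)"] by simp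
    then show ?thesis by (simp add: prob_space)
  qed
  have Zsq: "(norm (Z j \<omega>))\<^sup>2 = 1 + (norm (\<phi> t))\<^sup>2 - 2 * Re (cnj (\<phi> t) * cis (t * X j \<omega>))" for j \<omega>
  proof -
    have "(norm (Z j \<omega>))\<^sup>2 = (norm (cis (t * X j \<omega>)))\<^sup>2 + (norm (\<phi> t))\<^sup>2 - 2 * Re (cnj (\<phi> t) * cis (t * X j \<omega>))"
      unfolding Z_def cmod_power2 by (simp add: power2_eq_square algebra_simps)
    then show ?thesis by simp
  qed
  have Zsq_int: "integrable M (\<lambda>\<omega>. (norm (Z j \<omega>))\<^sup>2)" if "j \<in> {1..n}" for j
    unfolding Zsq by (intro Bochner_Integration.integrable_diff integrable_const integrable_mult_right
      integrable_Re cint[OF that])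
  have Zsq_le: "expectation (\<lambda>\<omega>. (norm (Z j \<omega>))\<^sup>2) \<le> 1" if "j \<in> {1..n}" for j
  proof -
    have "expectation (\<lambda>\<omega>. (norm (Z j \<omega>))\<^sup>2) = 1 + (norm (\<phi> t))\<^sup>2 - 2 * Re (cnj (\<phi> t) * \<phi> t)"
    proof -
      have "integrable M (\<lambda>\<omega>. Re (cnj (\<phi> t) * cis (t * X j \<omega>)))"
        by (intro integrable_Re integrable_mult_right cint[OF that])
      then have "expectation (\<lambda>\<omega>. (norm (Z j \<omega>))\<^sup>2)
          = 1 + (norm (\<phi> t))\<^sup>2 - 2 * expectation (\<lambda>\<omega>. Re (cnj (\<phi> t) * cis (t * X j \<omega>)))"
        unfolding Zsq
        by (subst Bochner_Integration.integral_diff) (auto simp: prob_space simp del: times_complex.simps)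
      also have "expectation (\<lambda>\<omega>. Re (cnj (\<phi> t) * cis (t * X j \<omega>))) = Re (cnj (\<phi> t) * \<phi> t)"
        by (subst integral_Re) (use cint[OF that] in \<open>simp_all add: mean[OF that] del: times_complex.simps\<close>)
      finally show ?thesis .
    qed
    also have "\<dots> = 1 - (norm (\<phi> t))\<^sup>2"
      by (simp add: cmod_power2) (simp add: power2_eq_square)
    finally show ?thesis by simp
  qed
  have "expectation (\<lambda>\<omega>. (norm (\<Sum>j = 1..n. Z j \<omega>))\<^sup>2) = (\<Sum>j = 1..n. expectation (\<lambda>\<omega>. (norm (Z j \<omega>))\<^sup>2))"
  proof (rule expectation_norm_sum_indep_centered)
    show "indep_vars (\<lambda>_. borel) Z {1..n}"
      unfolding Z_def [abs_def] by (rule indep_vars_compose2[OF ind]) auto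
    show "(CLINT \<omega>|M. Z j \<omega>) = 0" if "j \<in> {1..n}" for j
      unfolding Z_def using cint[OF that] by (simp add: mean[OF that] prob_space)
    show "integrable M (Z j)" if "j \<in> {1..n}" for j
      unfolding Z_def [abs_def] using cint[OF that] by simp
  qed (use Zsq_int in auto)
  also have "\<dots> \<le> n"
    using sum_mono[of "{1..n}" "\<lambda>j. expectation (\<lambda>\<omega>. (norm (Z j \<omega>))\<^sup>2)" "\<lambda>_. 1"] Zsq_le by simp
  finally have sum_le: "expectation (\<lambda>\<omega>. (norm (\<Sum>j = 1..n. Z j \<omega>))\<^sup>2) \<le> n" .
  have eq: "(norm ((\<Sum>j = 1..n. cis (t * X j \<omega>)) / n - \<phi> t))\<^sup>2 = (norm (\<Sum>j = 1..n. Z j \<omega>))\<^sup>2 / n\<^sup>2" for \<omega>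
  proof -
    have "(\<Sum>j = 1..n. cis (t * X j \<omega>)) / n - \<phi> t = (\<Sum>j = 1..n. Z j \<omega>) / n"
      using n by (simp add: Z_def sum_subtractf diff_divide_distrib)
    then show ?thesis by (simp add: norm_divide power_divide)
  qed
  have int: "integrable M (\<lambda>\<omega>. (norm ((\<Sum>j = 1..n. cis (t * X j \<omega>)) / n - \<phi> t))\<^sup>2)"
  proof (rule integrable_const_bound)
    show "AE \<omega> in M. norm ((norm ((\<Sum>j = 1..n. cis (t * X j \<omega>)) / n - \<phi> t))\<^sup>2) \<le> 2\<^sup>2"
    proof (intro AE_I2)
      fix \<omega>
      have "norm (\<Sum>j = 1..n. cis (t * X j \<omega>)) \<le> n"
        using norm_sum[of "\<lambda>j. cis (t * X j \<omega>)" "{1..n}"] by simp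
      then have "norm ((\<Sum>j = 1..n. cis (t * X j \<omega>)) / n - \<phi> t) \<le> 1 + 1"
        using \<phi>_le n by (intro order.trans[OF norm_triangle_ineq4] add_mono) (auto simp: norm_divide divide_simps)
      then show "norm ((norm ((\<Sum>j = 1..n. cis (t * X j \<omega>)) / n - \<phi> t))\<^sup>2) \<le> 2\<^sup>2"
        using power_mono[of _ 2 2] by fastforce
    qed
  qed measurable
  have "(\<integral>\<^sup>+\<omega>. ennreal ((norm ((\<Sum>j = 1..n. cis (t * X j \<omega>)) / n - \<phi> t))\<^sup>2) \<partial>M)
      = ennreal (expectation (\<lambda>\<omega>. (norm ((\<Sum>j = 1..n. cis (t * X j \<omega>)) / n - \<phi> t))\<^sup>2))"
    by (intro nn_integral_eq_integral int) auto
  also have "\<dots> \<le> ennreal (n / n\<^sup>2)"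
    unfolding eq using sum_le by (auto intro!: ennreal_leI divide_right_mono)
  also have "n / n\<^sup>2 = 1 / n"
    by (simp add: power2_eq_square)
  finally show ?thesis .
qed

section \<open>The mean integrated square error\<close>

text \<open>
  Plancherel for weights supported in the band: the factor \<open>(1 / (2\<pi>))^2\<close> of the synthesis meets the
  factor \<open>2\<pi>\<close> of the inequality.
\<close>
lemma band_synthesis_square_integral_le:
  assumes "continuous_on {-a..a} g"
  shows "(\<integral>\<^sup>+x. ennreal ((norm (band_synthesis a g x))\<^sup>2) \<partial>lborel)
    \<le> ennreal (1 / (2 * pi)) * (\<integral>\<^sup>+t. ennreal ((norm (g t))\<^sup>2) * indicator {-a..a} t \<partial>lborel)"
proof -
  define G where "G t = indicator {-a..a} t *\<^sub>R g t" for t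
  have G: "integrable lborel G"
    using borel_integrable_atLeastAtMost'[OF assms] by (simp add: set_integrable_def G_def [abs_def])
  have F: "band_synthesis a g x = 1 / (2 * pi) * (CLINT t|lborel. G t * cis (- (t * x)))" for x
  proof -
    have "set_integrable lborel {-a..a} (\<lambda>t. g t * cis (- (t * x)))"
      using assms by (intro borel_integrable_atLeastAtMost' continuous_intros)
    from set_borel_integral_eq_integral(2)[OF this] show ?thesis
      by (simp add: band_synthesis_def set_lebesgue_integral_def G_def)
  qed
  have [measurable]: "G \<in> borel_measurable borel" using G by auto
  have "(\<integral>\<^sup>+x. ennreal ((norm (band_synthesis a g x))\<^sup>2) \<partial>lborel)
      = (\<integral>\<^sup>+x. ennreal ((1 / (2 * pi))\<^sup>2) * ennreal ((norm (CLINT t|lborel. G t * cis (- (t * x))))\<^sup>2) \<partial>lborel)"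
    by (intro nn_integral_cong) (simp add: F norm_mult norm_divide power_mult_distrib power_divide flip: ennreal_mult)
  also have "\<dots> = ennreal ((1 / (2 * pi))\<^sup>2) * (\<integral>\<^sup>+x. ennreal ((norm (CLINT t|lborel. G t * cis (- (t * x))))\<^sup>2) \<partial>lborel)"
    by (rule nn_integral_cmult) measurable
  also have "\<dots> \<le> ennreal ((1 / (2 * pi))\<^sup>2) * (2 * pi * (\<integral>\<^sup>+t. ennreal ((norm (G t))\<^sup>2) \<partial>lborel))"
    by (intro mult_left_mono plancherel_le[OF G]) simp
  also have "\<dots> = ennreal (1 / (2 * pi)) * (\<integral>\<^sup>+t. ennreal ((norm (G t))\<^sup>2) \<partial>lborel)"
    unfolding mult.assoc [symmetric] by (simp add: power2_eq_square flip: ennreal_mult)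
  also have "(\<integral>\<^sup>+t. ennreal ((norm (G t))\<^sup>2) \<partial>lborel) = (\<integral>\<^sup>+t. ennreal ((norm (g t))\<^sup>2) * indicator {-a..a} t \<partial>lborel)"
    by (intro nn_integral_cong) (simp add: G_def split: split_indicator)
  finally show ?thesis .
qed

text \<open>
  A density is arbitrary on null sets, so for \<open>r = 0\<close> the representation may fail there. One
  derivative makes \<open>f\<close> continuous; two continuous functions that agree almost everywhere agree, and the
  representation can then be differentiated.
\<close>
lemma higher_deriv_band_limited_density_AE:
  assumes f [measurable]: "f \<in> borel_measurable borel" and f_nonneg: "\<And>x. f x \<ge> 0"
    and M: "M = density lborel (\<lambda>x. ennreal (f x))" and prob: "prob_space M"
    and zero: "\<And>t. \<bar>t\<bar> > a \<Longrightarrow> char M t = 0" and a: "0 \<le> a"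
    and diff: "times_differentiable r f"
  shows "AE x in lborel. (deriv ^^ r) f x = Re (band_synthesis a (\<lambda>t. (- \<i> * t) ^ r * char M t) x)"
proof (cases r)
  case 0
  then show ?thesis
    using density_eq_band_synthesis_AE[OF f f_nonneg M prob zero a] by simp
next
  case (Suc k)
  interpret real_distribution M
    using prob by (simp add: M real_distribution_def real_distribution_axioms_def)
  have char_cont: "continuous_on S (char M)" for S
    by (intro continuous_at_imp_continuous_on ballI isCont_char)
  have "\<forall>x. f differentiable (at x)"
    using diff Suc by (auto simp: times_differentiable_def dest: spec[of _ 0])
  then have "continuous_on UNIV f"
    by (intro continuous_at_imp_continuous_on ballI differentiable_imp_continuous_within) auto
  then have "closed {x. f x = Re (band_synthesis a (char M) x)}"
    by (intro closed_Collect_eq continuous_intros continuous_band_synthesis char_cont)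
  moreover have "AE x in lebesgue. x \<in> {x. f x = Re (band_synthesis a (char M) x)}"
    using density_eq_band_synthesis_AE[OF f f_nonneg M prob zero a] by (intro AE_completion) simp
  ultimately have "x \<in> {x. f x = Re (band_synthesis a (char M) x)}" for x
    by (rule mem_closed_if_AE_lebesgue)
  then have "f = (\<lambda>x. Re (band_synthesis a (char M) x))"
    by auto
  then have "(deriv ^^ r) f = (deriv ^^ r) (\<lambda>x. Re (band_synthesis a (char M) x))"
    by (rule arg_cong)
  then show ?thesis
    unfolding higher_deriv_Re_band_synthesis[OF char_cont] by simp
qed

lemma sinc_deriv_estimator_eq_band_synthesis:
  assumes "0 < h"
  shows "sinc_deriv_estimator r n xs h =
    (\<lambda>x. Re (band_synthesis (1 / h) (\<lambda>t. (- \<i> * t) ^ r * ((\<Sum>j = 1..n. cis (t * xs j)) / n)) x))"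
proof -
  have "continuous_on {-(1/h)..1/h} (\<lambda>t. (\<Sum>j = 1..n. cis (t * xs j)) / complex_of_nat n)"
    unfolding divide_inverse by (intro continuous_intros)
  from higher_deriv_Re_band_synthesis[OF this, of r] show ?thesis
    unfolding sinc_deriv_estimator_def sinc_estimator_eq_band_synthesis[OF assms, abs_def] .
qed

text \<open>
  The bandwidth enters only through the band \<open>[-1/h, 1/h]\<close>, which has to contain the support of \<open>\<phi>\<close>.
  Under this condition the bias vanishes, and the error is the synthesis of the difference
  between the empirical and the true characteristic function.
\<close>
lemma (in prob_space) MISE_sinc_deriv_estimator_le:
  fixes X :: "nat \<Rightarrow> 'a \<Rightarrow> real" and n :: nat
  assumes n: "n \<ge> 1" and ind: "indep_vars (\<lambda>_. borel) X {1..n}"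
    and f_nonneg: "\<And>x. f x \<ge> 0"
    and dist: "\<And>j. j \<in> {1..n} \<Longrightarrow> distributed M lborel (X j) (\<lambda>x. ennreal (f x))"
    and diff: "times_differentiable r f"
    and char: "\<And>j. j \<in> {1..n} \<Longrightarrow> \<phi> = char (distr M borel (X j))"
    and zero: "\<And>t. \<bar>t\<bar> > 1 / h \<Longrightarrow> \<phi> t = 0" and h: "0 < h"
  shows "MISE M (\<lambda>\<omega>. sinc_deriv_estimator r n (\<lambda>j. X j \<omega>) h) ((deriv ^^ r) f)
    \<le> ennreal (1 / (pi * real n * h ^ (2 * r + 1)))"
proof -
  define a where "a = 1 / h"
  have a: "0 \<le> a" using h by (simp add: a_def)
  define emp where "emp \<omega> t = (\<Sum>j = 1..n. cis (t * X j \<omega>)) / n" for \<omega> and t :: real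
  have X [measurable]: "X j \<in> borel_measurable M" if "j \<in> {1..n}" for j
    using ind that by (auto simp: indep_vars_def)
  have f [measurable]: "f \<in> borel_measurable borel"
    using distributed_real_measurable[OF _ dist[of 1]] f_nonneg n by auto
  have law: "distr M borel (X 1) = density lborel (\<lambda>x. ennreal (f x))"
  proof -
    have "distr M borel (X 1) = distr M lborel (X 1)" by (rule distr_cong) auto
    also have "\<dots> = density lborel (\<lambda>x. ennreal (f x))"
      using n by (intro distributed_distr_eq_density dist) auto
    finally show ?thesis .
  qed
  have \<phi>: "\<phi> = char (distr M borel (X 1))"
    using n by (intro char) auto
  interpret law: real_distribution "distr M borel (X 1)"
    using n by (intro real_distribution_distr X) auto
  have \<phi>_cont: "continuous_on S \<phi>" for S
    unfolding \<phi> by (intro continuous_at_imp_continuous_on ballI law.isCont_char)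
  have [measurable]: "\<phi> \<in> borel_measurable borel"
    unfolding \<phi> by (rule law.char_measurable)
  have emp_cont: "continuous_on S (emp \<omega>)" for S \<omega>
    unfolding emp_def [abs_def] divide_inverse by (intro continuous_intros)
  have emp_meas [measurable]: "(\<lambda>(\<omega>, t). emp \<omega> t) \<in> borel_measurable (M \<Otimes>\<^sub>M borel)"
    unfolding emp_def split_beta divide_inverse
    by (intro borel_measurable_times borel_measurable_sum) measurable
  have true: "AE x in lborel. (deriv ^^ r) f x = Re (band_synthesis a (\<lambda>t. (- \<i> * t) ^ r * \<phi> t) x)"
    unfolding \<phi> using zero unfolding \<phi>
    by (intro higher_deriv_band_limited_density_AE f f_nonneg law law.prob_space_axioms a diff)
       (simp add: a_def)
  have est: "sinc_deriv_estimator r n (\<lambda>j. X j \<omega>) h x = Re (band_synthesis a (\<lambda>t. (- \<i> * t) ^ r * emp \<omega> t) x)" for \<omega> x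
    by (simp add: sinc_deriv_estimator_eq_band_synthesis[OF h] a_def emp_def)
  have ise: "(\<integral>\<^sup>+x. ennreal ((sinc_deriv_estimator r n (\<lambda>j. X j \<omega>) h x - (deriv ^^ r) f x)\<^sup>2) \<partial>lborel)
      \<le> ennreal (1 / (2 * pi)) *
        (\<integral>\<^sup>+t. ennreal (a ^ (2 * r)) * indicator {-a..a} t * ennreal ((norm (emp \<omega> t - \<phi> t))\<^sup>2) \<partial>lborel)" for \<omega>
  proof -
    let ?g = "\<lambda>t. (- \<i> * complex_of_real t) ^ r * emp \<omega> t - (- \<i> * complex_of_real t) ^ r * \<phi> t"
    have g_cont: "continuous_on {-a..a} ?g"
      by (intro continuous_on_diff continuous_on_frequency_power emp_cont \<phi>_cont)
    have "(\<integral>\<^sup>+x. ennreal ((sinc_deriv_estimator r n (\<lambda>j. X j \<omega>) h x - (deriv ^^ r) f x)\<^sup>2) \<partial>lborel)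
        = (\<integral>\<^sup>+x. ennreal ((Re (band_synthesis a ?g x))\<^sup>2) \<partial>lborel)"
    proof (rule nn_integral_cong_AE)
      have split: "band_synthesis a ?g x = band_synthesis a (\<lambda>t. (- \<i> * t) ^ r * emp \<omega> t) x
          - band_synthesis a (\<lambda>t. (- \<i> * t) ^ r * \<phi> t) x" for x
        by (intro band_synthesis_diff continuous_on_frequency_power emp_cont \<phi>_cont)
      show "AE x in lborel. ennreal ((sinc_deriv_estimator r n (\<lambda>j. X j \<omega>) h x - (deriv ^^ r) f x)\<^sup>2)
          = ennreal ((Re (band_synthesis a ?g x))\<^sup>2)"
        using true by eventually_elim (simp only: est split minus_complex.sel)
    qed
    also have "\<dots> \<le> (\<integral>\<^sup>+x. ennreal ((norm (band_synthesis a ?g x))\<^sup>2) \<partial>lborel)"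
      by (intro nn_integral_mono ennreal_leI) (simp add: cmod_power2)
    also have "\<dots> \<le> ennreal (1 / (2 * pi)) * (\<integral>\<^sup>+t. ennreal ((norm (?g t))\<^sup>2) * indicator {-a..a} t \<partial>lborel)"
      by (rule band_synthesis_square_integral_le[OF g_cont])
    also have "\<dots> \<le> ennreal (1 / (2 * pi)) *
        (\<integral>\<^sup>+t. ennreal (a ^ (2 * r)) * indicator {-a..a} t * ennreal ((norm (emp \<omega> t - \<phi> t))\<^sup>2) \<partial>lborel)"
    proof (intro mult_left_mono nn_integral_mono)
      fix t :: real
      show "ennreal ((norm (?g t))\<^sup>2) * indicator {-a..a} t
        \<le> ennreal (a ^ (2 * r)) * indicator {-a..a} t * ennreal ((norm (emp \<omega> t - \<phi> t))\<^sup>2)"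
      proof (cases "t \<in> {-a..a}")
        case True
        have "(norm (?g t))\<^sup>2 = \<bar>t\<bar> ^ (2 * r) * (norm (emp \<omega> t - \<phi> t))\<^sup>2"
          unfolding right_diff_distrib [symmetric]
          by (simp add: norm_mult norm_power power_mult_distrib power_mult mult.commute flip: power_mult)
        also have "\<dots> \<le> a ^ (2 * r) * (norm (emp \<omega> t - \<phi> t))\<^sup>2"
          using True by (intro mult_right_mono power_mono) auto
        finally show ?thesis
          using True a by (simp add: ennreal_leI flip: ennreal_mult)
      qed simp
    qed simp
    finally show ?thesis .
  qed
  \<comment> \<open>Tonelli moves the expectation inside the frequency integral, where it meets one
    frequency at a time.\<close>
  let ?D = "\<lambda>\<omega> t. ennreal ((norm (emp \<omega> t - \<phi> t))\<^sup>2)"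
  let ?w = "\<lambda>t. ennreal (a ^ (2 * r)) * indicator {-a..a} t"
  interpret pair_sigma_finite M lborel ..
  have "(\<integral>\<^sup>+\<omega>. (\<integral>\<^sup>+t. ?w t * ?D \<omega> t \<partial>lborel) \<partial>M) = (\<integral>\<^sup>+t. (\<integral>\<^sup>+\<omega>. ?w t * ?D \<omega> t \<partial>M) \<partial>lborel)"
    by (rule Fubini' [symmetric]) measurable
  also have "\<dots> = (\<integral>\<^sup>+t. ?w t * (\<integral>\<^sup>+\<omega>. ?D \<omega> t \<partial>M) \<partial>lborel)"
    by (intro nn_integral_cong nn_integral_cmult) measurable
  also have "\<dots> \<le> (\<integral>\<^sup>+t. ?w t * ennreal (1 / n) \<partial>lborel)"
    unfolding emp_def
    by (intro nn_integral_mono mult_left_mono empirical_char_mean_square_error_le n ind char) auto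
  also have "\<dots> = ennreal (a ^ (2 * r)) * ennreal (2 * a) * ennreal (1 / n)"
    using a by (simp add: nn_integral_cmult nn_integral_multc ennreal_mult)
  also have "\<dots> = ennreal (a ^ (2 * r) * (2 * a) * (1 / n))"
  proof -
    have "0 \<le> a ^ (2 * r)" "0 \<le> 2 * a" "0 \<le> a ^ (2 * r) * (2 * a)" "0 \<le> 1 / real n"
      using a by auto
    then show ?thesis by (simp only: ennreal_mult)
  qed
  finally have mean: "(\<integral>\<^sup>+\<omega>. (\<integral>\<^sup>+t. ?w t * ?D \<omega> t \<partial>lborel) \<partial>M) \<le> ennreal (a ^ (2 * r) * (2 * a) * (1 / n))" .
  have "MISE M (\<lambda>\<omega>. sinc_deriv_estimator r n (\<lambda>j. X j \<omega>) h) ((deriv ^^ r) f)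
      \<le> (\<integral>\<^sup>+\<omega>. ennreal (1 / (2 * pi)) * (\<integral>\<^sup>+t. ?w t * ?D \<omega> t \<partial>lborel) \<partial>M)"
    unfolding MISE_def by (intro nn_integral_mono ise)
  also have "\<dots> = ennreal (1 / (2 * pi)) * (\<integral>\<^sup>+\<omega>. (\<integral>\<^sup>+t. ?w t * ?D \<omega> t \<partial>lborel) \<partial>M)"
    by (rule nn_integral_cmult) measurable
  also have "\<dots> \<le> ennreal (1 / (2 * pi)) * ennreal (a ^ (2 * r) * (2 * a) * (1 / n))"
    by (intro mult_left_mono mean) simp
  also have "\<dots> = ennreal (1 / (2 * pi) * (a ^ (2 * r) * (2 * a) * (1 / n)))"
    using a by (intro ennreal_mult [symmetric]) auto
  also have "1 / (2 * pi) * (a ^ (2 * r) * (2 * a) * (1 / n)) = 1 / (pi * real n * h ^ (2 * r + 1))"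
    by (simp add: a_def power_one_over)
  finally show ?thesis .
qed

theorem theorem9p3:
  fixes M :: "'a measure" and X :: "nat \<Rightarrow> 'a \<Rightarrow> real" and f :: "real \<Rightarrow> real"
    and \<phi> :: "real \<Rightarrow> complex" and r n :: nat and T :: real
  assumes "prob_space M"
    and "n \<ge> 1"
    and "prob_space.indep_vars M (\<lambda>_. borel) X {1..n}"
    and "\<And>x. f x \<ge> 0"
    and "\<And>j. j \<in> {1..n} \<Longrightarrow> distributed M lborel (X j) (\<lambda>x. ennreal (f x))"
    and "times_differentiable r f"
    and "\<And>j. j \<in> {1..n} \<Longrightarrow> \<phi> = char (distr M borel (X j))"
    and "T > 0"
    and "\<And>t. \<bar>t\<bar> > T \<Longrightarrow> \<phi> t = 0"
  shows "(\<forall>h. 0 < h \<and> h \<le> 1 / T \<longrightarrow>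
            MISE M (\<lambda>\<omega>. sinc_deriv_estimator r n (\<lambda>j. X j \<omega>) h) ((deriv ^^ r) f)
              \<le> ennreal (1 / (pi * real n * h ^ (2 * r + 1))))
         \<and> MISE M (\<lambda>\<omega>. sinc_deriv_estimator r n (\<lambda>j. X j \<omega>) (1 / T)) ((deriv ^^ r) f)
              \<le> ennreal (T ^ (2 * r + 1) / (pi * real n))"
proof -
  interpret prob_space M by (rule assms(1))
  have bound: "MISE M (\<lambda>\<omega>. sinc_deriv_estimator r n (\<lambda>j. X j \<omega>) h) ((deriv ^^ r) f)
      \<le> ennreal (1 / (pi * real n * h ^ (2 * r + 1)))" if h: "0 < h" "h \<le> 1 / T" for h
  proof (rule MISE_sinc_deriv_estimator_le[OF assms(2-7)])
    have "T \<le> 1 / h"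
      using h \<open>T > 0\<close> by (simp add: field_simps)
    then show "\<phi> t = 0" if "\<bar>t\<bar> > 1 / h" for t
      using that by (intro assms(9)) simp
  qed (use h in auto)
  have "1 / (pi * real n * (1 / T) ^ (2 * r + 1)) = T ^ (2 * r + 1) / (pi * real n)"
    using \<open>T > 0\<close> by (simp add: power_one_over)
  with bound bound[of "1 / T"] \<open>T > 0\<close> show ?thesis
    by simp
qed

end
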